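(* Let $\alpha$ and $\beta$ be real numbers with $\alpha<\beta$. If $u:\mathbb{B}^2\to(\alpha,\beta)$ is a harmonic function (into $(\alpha,\beta)$), then $$|\nabla u(z)|\le\frac{2(\beta-\alpha)}{\pi}\cdot\frac{\cos\left(\frac{\pi}{\beta-\alpha}\left(u(z)-\frac{\alpha+\beta}{2}\right)\right)}{1-|z|^2},\qquad z\in\mathbb{B}^2.$$ The result is sharp: for all $\alpha<\beta$ there are a harmonic function $u:\mathbb{B}^2\to(\alpha,\beta)$ and a point $z\in\mathbb{B}^2$ for which equality holds.
   Context: $\mathbb{B}^2$ is the open unit disk in the plane, $\nabla u=(\partial u/\partial x_1,\partial u/\partial x_2)$ is the gradient and $|\cdot|$ the Euclidean norm. *)

theory Defs
  imports "HOL-Analysis.Analysis"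
begin

text \<open>The plane is the type \<open>complex\<close>, viewed as a real Euclidean space with orthonormal basis
  \<open>{1, \<i>}\<close>, so that \<open>norm\<close> is the Euclidean norm; the unit disk is \<open>ball 0 1\<close>.
  The differential operators are defined on any Euclidean space.\<close>

definition partial_deriv :: "'a::euclidean_space \<Rightarrow> ('a \<Rightarrow> real) \<Rightarrow> 'a \<Rightarrow> real" where
  "partial_deriv b u x = deriv (\<lambda>t. u (x + t *\<^sub>R b)) 0"

definition gradient :: "('a::euclidean_space \<Rightarrow> real) \<Rightarrow> 'a \<Rightarrow> 'a" where
  "gradient u x = (\<Sum>b\<in>Basis. partial_deriv b u x *\<^sub>R b)"

definition laplacian :: "('a::euclidean_space \<Rightarrow> real) \<Rightarrow> 'a \<Rightarrow> real" where
  "laplacian u x = (\<Sum>b\<in>Basis. partial_deriv b (partial_deriv b u) x)"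

text \<open>\<open>C\<^sup>2\<close> on an open set: twice (Frechet) differentiable with continuous second-order partial
  derivatives. Since \<open>deriv\<close> is a total function, differentiability is required explicitly.
  Only the values of \<open>u\<close> on \<open>S\<close> matter when \<open>S\<close> is open.\<close>

definition twice_continuously_differentiable_on ::
    "'a::euclidean_space set \<Rightarrow> ('a \<Rightarrow> real) \<Rightarrow> bool" where
  "twice_continuously_differentiable_on S u \<longleftrightarrow>
     (\<forall>x\<in>S. u differentiable (at x)) \<and>
     (\<forall>b\<in>Basis. \<forall>x\<in>S. partial_deriv b u differentiable (at x)) \<and>
     (\<forall>b\<in>Basis. \<forall>c\<in>Basis. continuous_on S (partial_deriv c (partial_deriv b u)))"

definition harmonic_on :: "'a::euclidean_space set \<Rightarrow> ('a \<Rightarrow> real) \<Rightarrow> bool" where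
  "harmonic_on S u \<longleftrightarrow> open S \<and> twice_continuously_differentiable_on S u \<and>
     (\<forall>x\<in>S. laplacian u x = 0)"

lemma partial_deriv_eq:
  assumes "(u has_derivative u') (at x)"
  shows "partial_deriv b u x = u' b"
proof -
  have l: "linear u'" using assms by (rule has_derivative_linear)
  have "((\<lambda>t::real. u (x + t *\<^sub>R b)) has_derivative (\<lambda>t. u' (t *\<^sub>R b))) (at 0)"
    by (rule has_derivative_compose[where g = u]) (auto intro!: derivative_eq_intros simp: assms)
  moreover have "(\<lambda>t. u' (t *\<^sub>R b)) = (*) (u' b)"
    by (auto simp: linear_scale[OF l] mult.commute)
  ultimately show ?thesis
    unfolding partial_deriv_def by (intro DERIV_imp_deriv) (simp add: has_field_derivative_def)
qed

lemma gradient_eq_GDERIV: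
  assumes "GDERIV u x :> D"
  shows "gradient u x = D"
  using assms
  by (simp add: gradient_def gderiv_def partial_deriv_eq inner_commute[of _ D] euclidean_representation)

lemma gradient_complex:
  fixes u :: "complex \<Rightarrow> real"
  shows "gradient u z = Complex (partial_deriv 1 u z) (partial_deriv \<i> u z)"
  by (simp add: gradient_def Basis_complex_def complex_eq_iff)

end

theory Submission
  imports Defs "HOL-Complex_Analysis.Riemann_Mapping"
begin

text \<open>The disk is convex, so a harmonic \<open>u\<close> on it is the real part of a holomorphic \<open>f\<close>, and
  \<open>\<bar>\<nabla>u\<bar> = \<bar>f'\<bar>\<close> by the Cauchy--Riemann equations. The gradient bound is therefore the
  Schwarz--Pick lemma for holomorphic maps from the disk into a vertical strip.

  An affine change of variable with slope \<open>c = \<pi> / (\<beta> - \<alpha>)\<close> turns \<open>f\<close> into a map \<open>w\<close> with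
  \<open>\<bar>Re w\<bar> < \<pi> / 2\<close>. Then \<open>p = exp (\<i> w)\<close> has positive real part \<open>exp (- Im w) cos (Re w)\<close>,
  and Schwarz--Pick for the right half-plane says
  \<open>\<bar>p'\<bar> \<le> 2 Re p / (1 - \<bar>z\<bar>\<^sup>2)\<close> (\<open>norm_deriv_le_of_Re_pos\<close>). Since
  \<open>\<bar>p'\<bar> = exp (- Im w) \<bar>w'\<bar>\<close>, the exponential factors cancel and
  \<open>\<bar>w'\<bar> \<le> 2 cos (Re w) / (1 - \<bar>z\<bar>\<^sup>2)\<close> remains (\<open>norm_deriv_le_cos_of_Re_strip\<close>).
  Dividing by \<open>c\<close> gives the estimate.

  Schwarz--Pick is an equality for conformal bijections, so the conformal map of the disk onto the
  strip is extremal; this is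
  \<open>f z = (\<alpha> + \<beta>) / 2 - (\<i> / c) Ln ((1 + z) / (1 - z))\<close>, and equality is read off at \<open>z = 0\<close>.

  The holomorphic \<open>f\<close> is a primitive of \<open>g = u\<^sub>x - \<i> u\<^sub>y\<close>
  (\<open>harmonic_on_convex_imp_Re_holomorphic\<close>). Of the two Cauchy--Riemann equations for \<open>g\<close>, one
  is the Laplace equation and the other is the symmetry of the mixed partial derivatives of \<open>u\<close>
  (\<open>mixed_partial_derivs_commute\<close>).\<close>

section \<open>Equality of mixed partial derivatives\<close>

lemma has_real_derivative_along_line:
  assumes "u differentiable (at (y + s *\<^sub>R b))"
  shows "((\<lambda>t. u (y + t *\<^sub>R b)) has_real_derivative partial_deriv b u (y + s *\<^sub>R b)) (at s)"
proof -
  from assms obtain u' where u': "(u has_derivative u') (at (y + s *\<^sub>R b))"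
    by (auto simp: differentiable_def)
  have l: "linear u'" using u' by (rule has_derivative_linear)
  have "((\<lambda>t::real. u (y + t *\<^sub>R b)) has_derivative (\<lambda>t. u' (t *\<^sub>R b))) (at s)"
    by (rule has_derivative_compose[where g = u]) (auto intro!: derivative_eq_intros simp: u')
  moreover have "(\<lambda>t. u' (t *\<^sub>R b)) = (*) (u' b)"
    by (auto simp: linear_scale[OF l] mult.commute)
  ultimately show ?thesis
    by (simp add: has_field_derivative_def partial_deriv_eq[OF u'])
qed

text \<open>Two applications of the mean value theorem: first in the direction \<open>b\<close>, to the increment of
  \<open>u\<close> in the direction \<open>c\<close>, and then in the direction \<open>c\<close>, to the partial derivative that this
  produces. The left-hand side is symmetric in \<open>b\<close> and \<open>c\<close>, which is what makes the order of
  differentiation irrelevant in the limit.\<close>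

lemma second_difference_mean_value:
  fixes u :: "'a::euclidean_space \<Rightarrow> real"
  assumes u: "\<And>y. y \<in> S \<Longrightarrow> u differentiable (at y)"
    and pd: "\<And>y. y \<in> S \<Longrightarrow> partial_deriv b u differentiable (at y)"
    and S: "\<And>s t. 0 \<le> s \<Longrightarrow> s \<le> h \<Longrightarrow> 0 \<le> t \<Longrightarrow> t \<le> h \<Longrightarrow> x + s *\<^sub>R b + t *\<^sub>R c \<in> S"
    and "0 < h"
  obtains s t where "0 < s" "s < h" "0 < t" "t < h"
    "u (x + h *\<^sub>R b + h *\<^sub>R c) - u (x + h *\<^sub>R b) - (u (x + h *\<^sub>R c) - u x)
       = h * (h * partial_deriv c (partial_deriv b u) (x + s *\<^sub>R b + t *\<^sub>R c))"
proof -
  define \<phi> where "\<phi> s = u ((x + h *\<^sub>R c) + s *\<^sub>R b) - u (x + s *\<^sub>R b)" for s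
  have "\<exists>s>0. s < h \<and> \<phi> h - \<phi> 0 = (h - 0) *
      (partial_deriv b u ((x + h *\<^sub>R c) + s *\<^sub>R b) - partial_deriv b u (x + s *\<^sub>R b))"
  proof (rule MVT2)
    fix s assume s: "0 \<le> s" "s \<le> h"
    have "(x + h *\<^sub>R c) + s *\<^sub>R b \<in> S" "x + s *\<^sub>R b \<in> S"
      using S[of s h] S[of s 0] s \<open>0 < h\<close> by (auto simp: algebra_simps)
    then show "(\<phi> has_real_derivative
        partial_deriv b u ((x + h *\<^sub>R c) + s *\<^sub>R b) - partial_deriv b u (x + s *\<^sub>R b)) (at s)"
      unfolding \<phi>_def by (intro DERIV_diff has_real_derivative_along_line u)
  qed fact
  then obtain s where s: "0 < s" "s < h" and \<phi>: "\<phi> h - \<phi> 0 = h *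
      (partial_deriv b u ((x + h *\<^sub>R c) + s *\<^sub>R b) - partial_deriv b u (x + s *\<^sub>R b))"
    by auto
  have "\<exists>t>0. t < h \<and> partial_deriv b u (x + s *\<^sub>R b + h *\<^sub>R c) - partial_deriv b u (x + s *\<^sub>R b + 0 *\<^sub>R c)
      = (h - 0) * partial_deriv c (partial_deriv b u) (x + s *\<^sub>R b + t *\<^sub>R c)"
    by (rule MVT2) (use S[of s] s in \<open>auto intro!: has_real_derivative_along_line pd \<open>0 < h\<close>\<close>)
  then obtain t where t: "0 < t" "t < h"
    "partial_deriv b u (x + s *\<^sub>R b + h *\<^sub>R c) - partial_deriv b u (x + s *\<^sub>R b)
      = h * partial_deriv c (partial_deriv b u) (x + s *\<^sub>R b + t *\<^sub>R c)"
    by auto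
  show ?thesis
    by (rule that[OF s t(1,2)]) (use \<phi> t(3) in \<open>simp add: \<phi>_def add_ac\<close>)
qed

text \<open>The same second difference over a small square at \<open>x\<close> is \<open>h\<^sup>2\<close> times a value of either mixed
  derivative near \<open>x\<close>. By continuity both values are close to those at \<open>x\<close>.\<close>

lemma mixed_partial_derivs_commute:
  fixes u :: "'a::euclidean_space \<Rightarrow> real"
  assumes u: "twice_continuously_differentiable_on S u"
    and "open S" "x \<in> S" and b: "b \<in> Basis" and c: "c \<in> Basis"
  shows "partial_deriv c (partial_deriv b u) x = partial_deriv b (partial_deriv c u) x"
proof -
  let ?D = "partial_deriv c (partial_deriv b u)" and ?E = "partial_deriv b (partial_deriv c u)"
  have "\<bar>?D x - ?E x\<bar> \<le> e" if "e > 0" for e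
  proof -
    have "isCont ?D x" "isCont ?E x"
      using u b c \<open>open S\<close> \<open>x \<in> S\<close>
      by (auto simp: twice_continuously_differentiable_on_def continuous_on_eq_continuous_at)
    then obtain d1 d2 where d1: "d1 > 0" "\<And>y. dist y x < d1 \<Longrightarrow> dist (?D y) (?D x) < e/2"
      and d2: "d2 > 0" "\<And>y. dist y x < d2 \<Longrightarrow> dist (?E y) (?E x) < e/2"
      using \<open>e > 0\<close> unfolding continuous_at_eps_delta by (metis half_gt_zero)
    obtain d3 where d3: "d3 > 0" "ball x d3 \<subseteq> S"
      using \<open>open S\<close> \<open>x \<in> S\<close> open_contains_ball by blast
    define d where "d = Min {d1, d2, d3}"
    have d: "d > 0" "d \<le> d1" "d \<le> d2" "d \<le> d3"
      using d1(1) d2(1) d3(1) by (auto simp: d_def)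
    \<comment> \<open>The far corner of the square is at distance at most \<open>2 * h\<close> from \<open>x\<close>, so it stays in the
      open ball of radius \<open>d\<close>.\<close>
    define h where "h = d / 4"
    have h: "h > 0" using d by (simp add: h_def)
    have near: "dist (x + s *\<^sub>R v + t *\<^sub>R w) x < d"
      if "0 \<le> s" "s \<le> h" "0 \<le> t" "t \<le> h" "v \<in> Basis" "w \<in> Basis" for s t v w
    proof -
      have "dist (x + s *\<^sub>R v + t *\<^sub>R w) x \<le> norm (s *\<^sub>R v) + norm (t *\<^sub>R w)"
        by (metis add.assoc add_diff_cancel_left' dist_norm norm_triangle_ineq)
      also have "\<dots> \<le> h + h" using that by (simp add: norm_Basis)
      finally show ?thesis using d by (simp add: h_def)
    qed
    have inS: "x + s *\<^sub>R v + t *\<^sub>R w \<in> S"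
      if "0 \<le> s" "s \<le> h" "0 \<le> t" "t \<le> h" "v \<in> Basis" "w \<in> Basis" for s t v w
      using near[OF that] d3(2) d(4) by (force simp: dist_commute)
    obtain s t where st: "0 < s" "s < h" "0 < t" "t < h"
      "u (x + h *\<^sub>R b + h *\<^sub>R c) - u (x + h *\<^sub>R b) - (u (x + h *\<^sub>R c) - u x)
       = h * (h * ?D (x + s *\<^sub>R b + t *\<^sub>R c))"
      by (rule second_difference_mean_value[of S u b h x c])
        (use u b c h inS in \<open>auto simp: twice_continuously_differentiable_on_def\<close>)
    obtain s' t' where st': "0 < s'" "s' < h" "0 < t'" "t' < h"
      "u (x + h *\<^sub>R c + h *\<^sub>R b) - u (x + h *\<^sub>R c) - (u (x + h *\<^sub>R b) - u x)
       = h * (h * ?E (x + s' *\<^sub>R c + t' *\<^sub>R b))"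
      by (rule second_difference_mean_value[of S u c h x b])
        (use u b c h inS in \<open>auto simp: twice_continuously_differentiable_on_def\<close>)
    have "h * (h * ?D (x + s *\<^sub>R b + t *\<^sub>R c)) = h * (h * ?E (x + s' *\<^sub>R c + t' *\<^sub>R b))"
      unfolding st(5)[symmetric] st'(5)[symmetric] by (simp add: add_ac)
    then have "?D (x + s *\<^sub>R b + t *\<^sub>R c) = ?E (x + s' *\<^sub>R c + t' *\<^sub>R b)"
      using h by simp
    moreover have "dist (?D (x + s *\<^sub>R b + t *\<^sub>R c)) (?D x) < e/2"
      using near[of s t b c] st b c d(2) by (intro d1(2)) simp
    moreover have "dist (?E (x + s' *\<^sub>R c + t' *\<^sub>R b)) (?E x) < e/2"
      using near[of s' t' c b] st' b c d(3) by (intro d2(2)) simp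
    ultimately show ?thesis unfolding dist_real_def by linarith
  qed
  then have "\<bar>?D x - ?E x\<bar> \<le> 0" by (rule field_le_epsilon[of _ 0, simplified])
  then show ?thesis by simp
qed

section \<open>Harmonic functions as real parts of holomorphic functions\<close>

text \<open>The function \<open>u\<close> is compared with \<open>Re \<circ> f\<close> on \<open>S\<close> only, so that this applies again to a partial
  derivative of \<open>u\<close>, which is known as a real part only there.\<close>

lemma Re_holomorphic_has_derivative:
  assumes f: "f holomorphic_on S" and "open S" "z \<in> S"
    and u: "\<And>z. z \<in> S \<Longrightarrow> u z = Re (f z)"
  shows "(u has_derivative (\<lambda>h. Re (deriv f z * h))) (at z)"
proof -
  have "(f has_derivative (*) (deriv f z)) (at z)"
    using holomorphic_derivI[OF f \<open>open S\<close> \<open>z \<in> S\<close>] by (simp add: has_field_derivative_def)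
  then have "((\<lambda>z. Re (f z)) has_derivative (\<lambda>h. Re (deriv f z * h))) (at z)"
    by (rule has_derivative_Re)
  then show ?thesis
    by (rule has_derivative_transform_within_open[OF _ \<open>open S\<close> \<open>z \<in> S\<close>]) (simp add: u)
qed

lemma partial_deriv_Re_holomorphic:
  assumes "f holomorphic_on S" "open S" "\<And>z. z \<in> S \<Longrightarrow> u z = Re (f z)" "z \<in> S"
  shows "partial_deriv b u z = Re (b * deriv f z)"
  using partial_deriv_eq[OF Re_holomorphic_has_derivative[OF assms(1,2,4,3)]]
  by (simp add: mult.commute)

lemma norm_gradient_Re_holomorphic:
  assumes "f holomorphic_on S" "open S" "\<And>z. z \<in> S \<Longrightarrow> u z = Re (f z)" "z \<in> S"
  shows "norm (gradient u z) = norm (deriv f z)"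
proof -
  have "gradient u z = cnj (deriv f z)"
    by (simp add: gradient_complex partial_deriv_Re_holomorphic[OF assms] complex_eq_iff)
  then show ?thesis by simp
qed

text \<open>Each partial derivative in a direction \<open>b\<close> is the real part of the holomorphic \<open>b f'\<close>, so the
  second derivatives are the real parts of \<open>b c f''\<close>. The Laplacian vanishes
  because \<open>1\<^sup>2 + \<i>\<^sup>2 = 0\<close>.\<close>

lemma harmonic_on_Re_holomorphic:
  assumes f: "f holomorphic_on S" and S: "open S" and u: "\<And>z. z \<in> S \<Longrightarrow> u z = Re (f z)"
  shows "harmonic_on S u"
proof -
  have f': "(\<lambda>z. b * deriv f z) holomorphic_on S" for b
    by (intro holomorphic_intros holomorphic_deriv f S)
  note pd = partial_deriv_Re_holomorphic[OF f S u]
  have pd2: "partial_deriv c (partial_deriv b u) z = Re (c * (b * deriv (deriv f) z))"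
    if "z \<in> S" for b c z
  proof -
    have "deriv (\<lambda>z. b * deriv f z) z = b * deriv (deriv f) z"
      by (intro deriv_cmult holomorphic_on_imp_differentiable_at[OF _ S that] holomorphic_deriv f S)
    then show ?thesis
      using partial_deriv_Re_holomorphic[OF f'[of b] S pd[where b = b] that, where b = c] by simp
  qed
  have "continuous_on S (\<lambda>z. Re (c * (b * deriv (deriv f) z)))" for b c
    by (intro continuous_intros holomorphic_on_imp_continuous_on holomorphic_deriv f S)
  then have "continuous_on S (partial_deriv c (partial_deriv b u))" for b c
    by (simp add: pd2 cong: continuous_on_cong)
  moreover have "u differentiable (at z)" if "z \<in> S" for z
    using Re_holomorphic_has_derivative[OF f S that u] by (auto simp: differentiable_def)
  moreover have "partial_deriv b u differentiable (at z)" if "z \<in> S" for z b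
    using Re_holomorphic_has_derivative[OF f' S that pd] by (auto simp: differentiable_def)
  ultimately show ?thesis
    using S by (simp add: harmonic_on_def twice_continuously_differentiable_on_def
        laplacian_def Basis_complex_def pd2)
qed

text \<open>If \<open>u = Re f\<close> then \<open>f' = u\<^sub>x - \<i> u\<^sub>y\<close>. The function on the right is holomorphic for every
  harmonic \<open>u\<close>, so Cauchy's theorem supplies a primitive on a convex set, whose real part
  has the gradient of \<open>u\<close> and thus differs from \<open>u\<close> by a constant.\<close>

lemma harmonic_on_convex_imp_Re_holomorphic:
  assumes u: "harmonic_on S u" and "convex S"
  obtains f where "f holomorphic_on S" "\<And>z. z \<in> S \<Longrightarrow> u z = Re (f z)"
proof -
  have S: "open S" and C2: "twice_continuously_differentiable_on S u"
    and lap: "\<And>z. z \<in> S \<Longrightarrow> laplacian u z = 0"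
    using u by (auto simp: harmonic_on_def)
  have lin: "A h = Re h * A 1 + Im h * A \<i>" if "linear A" for A :: "complex \<Rightarrow> real" and h
  proof -
    have "A (Re h *\<^sub>R 1 + Im h *\<^sub>R \<i>) = Re h * A 1 + Im h * A \<i>"
      by (simp add: linear_add[OF that] linear_scale[OF that])
    moreover have "Re h *\<^sub>R 1 + Im h *\<^sub>R \<i> = h" by (simp add: complex_eq_iff)
    ultimately show ?thesis by simp
  qed
  define g where "g z = Complex (partial_deriv 1 u z) (- partial_deriv \<i> u z)" for z
  have "g field_differentiable (at z)" if z: "z \<in> S" for z
  proof -
    have "partial_deriv 1 u differentiable (at z)" "partial_deriv \<i> u differentiable (at z)"
      using C2 z by (auto simp: twice_continuously_differentiable_on_def Basis_complex_def)
    then obtain A B where A: "(partial_deriv 1 u has_derivative A) (at z)"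
      and B: "(partial_deriv \<i> u has_derivative B) (at z)"
      by (auto simp: differentiable_def)
    \<comment> \<open>The two Cauchy--Riemann equations for \<open>g\<close>.\<close>
    have "A \<i> = B 1"
      using mixed_partial_derivs_commute[OF C2 S z, of 1 \<i>]
      by (simp add: partial_deriv_eq[OF A] partial_deriv_eq[OF B] Basis_complex_def)
    moreover have "B \<i> = - A 1"
      using lap[OF z]
      by (simp add: laplacian_def Basis_complex_def partial_deriv_eq[OF A] partial_deriv_eq[OF B])
    ultimately have eq: "complex_of_real (A h) - \<i> * of_real (B h) = Complex (A 1) (- B 1) * h" for h
      using lin[OF has_derivative_linear[OF A], of h] lin[OF has_derivative_linear[OF B], of h]
      by (simp add: complex_eq_iff algebra_simps)
    have "((\<lambda>z. complex_of_real (partial_deriv 1 u z) - \<i> * of_real (partial_deriv \<i> u z))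
        has_derivative (\<lambda>h. complex_of_real (A h) - \<i> * of_real (B h))) (at z)"
      by (intro derivative_intros A B)
    also have "(\<lambda>z. complex_of_real (partial_deriv 1 u z) - \<i> * of_real (partial_deriv \<i> u z)) = g"
      by (simp add: g_def complex_eq_iff fun_eq_iff)
    finally show ?thesis
      unfolding eq by (auto simp: field_differentiable_def has_field_derivative_def)
  qed
  then have "g holomorphic_on S"
    by (simp add: holomorphic_on_def field_differentiable_at_within)
  then obtain F where F': "\<And>z. z \<in> S \<Longrightarrow> (F has_field_derivative g z) (at z within S)"
    using holomorphic_convex_primitive'[OF \<open>convex S\<close> S] by blast
  then have F: "(F has_field_derivative g z) (at z)" if "z \<in> S" for z
    using that S by (metis at_within_open)
  have "((\<lambda>z. u z - Re (F z)) has_derivative (\<lambda>h. 0)) (at z within S)" if z: "z \<in> S" for z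
  proof -
    obtain u' where u': "(u has_derivative u') (at z)"
      using C2 z by (auto simp: twice_continuously_differentiable_on_def differentiable_def)
    have "((\<lambda>z. u z - Re (F z)) has_derivative (\<lambda>h. u' h - Re (g z * h))) (at z)"
      using F[OF z] by (intro derivative_intros u') (simp add: has_field_derivative_def)
    also have "(\<lambda>h. u' h - Re (g z * h)) = (\<lambda>h. 0)"
    proof
      fix h show "u' h - Re (g z * h) = 0"
        using lin[OF has_derivative_linear[OF u'], of h]
        by (simp add: g_def partial_deriv_eq[OF u'] algebra_simps)
    qed
    finally show ?thesis by (rule has_derivative_at_withinI)
  qed
  then have "\<exists>k. \<forall>z\<in>S. u z - Re (F z) = k"
    by (rule has_derivative_zero_constant[OF \<open>convex S\<close>])
  then obtain k where k: "\<And>z. z \<in> S \<Longrightarrow> u z - Re (F z) = k"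
    by blast
  have "F holomorphic_on S"
    using F S by (auto simp: holomorphic_on_open)
  show ?thesis
  proof
    show "(\<lambda>z. F z + of_real k) holomorphic_on S"
      by (intro holomorphic_intros \<open>F holomorphic_on S\<close>)
    show "u z = Re (F z + of_real k)" if "z \<in> S" for z using k[OF that] by simp
  qed
qed

section \<open>Schwarz--Pick estimates for the half-plane and the strip\<close>

text \<open>The Schwarz lemma applies to \<open>p\<close> once it is normalised on both sides: precompose with the disk
  automorphism that sends \<open>0\<close> to \<open>z\<close>, whose derivative at \<open>0\<close> is \<open>1 - \<bar>z\<bar>\<^sup>2\<close>, and postcompose with
  the Cayley transform \<open>\<omega> \<mapsto> (\<omega> - p z) / (\<omega> + cnj (p z))\<close> of the right half-plane, whose
  derivative at \<open>p z\<close> is \<open>1 / (2 Re (p z))\<close>.\<close>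

lemma norm_deriv_le_of_Re_pos:
  assumes p: "p holomorphic_on ball 0 1"
    and pos: "\<And>z. norm z < 1 \<Longrightarrow> Re (p z) > 0"
    and z: "norm z < 1"
  shows "norm (deriv p z) \<le> 2 * Re (p z) / (1 - (norm z)\<^sup>2)"
proof -
  define M where "M = Moebius_function 0 (- z)"
  have M_lt: "norm (M \<zeta>) < 1" if "norm \<zeta> < 1" for \<zeta>
    unfolding M_def by (rule Moebius_function_norm_lt_1) (use z that in auto)
  have M_hol: "M holomorphic_on ball 0 1"
    unfolding M_def by (rule Moebius_function_holomorphic) (use z in simp)
  have M0: "M 0 = z" by (simp add: M_def Moebius_function_of_zero)
  have dM: "(M has_field_derivative of_real (1 - (norm z)\<^sup>2)) (at 0)"
    unfolding M_def Moebius_function_simple[abs_def]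
    by (auto intro!: derivative_eq_intros simp: complex_norm_square[unfolded of_real_power])
  have pM: "(\<lambda>\<zeta>. p (M \<zeta>)) holomorphic_on ball 0 1"
    using holomorphic_on_compose_gen[OF M_hol p] M_lt by (simp add: o_def image_subset_iff)
  have denom: "p (M \<zeta>) + cnj (p z) \<noteq> 0" if "norm \<zeta> < 1" for \<zeta>
    using pos[OF M_lt[OF that]] pos[OF z] by (auto simp: complex_eq_iff)
  define H where "H \<zeta> = (p (M \<zeta>) - p z) / (p (M \<zeta>) + cnj (p z))" for \<zeta>
  have "norm (deriv H 0) \<le> 1"
  proof (rule Schwarz_Lemma(2)[where \<xi> = 0])
    show "H holomorphic_on ball 0 1"
      unfolding H_def by (intro holomorphic_intros pM) (use denom in auto)
    show "H 0 = 0" by (simp add: H_def M0)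
    show "norm (H \<zeta>) < 1" if "norm \<zeta> < 1" for \<zeta>
    proof -
      have "(norm (p (M \<zeta>) + cnj (p z)))\<^sup>2 - (norm (p (M \<zeta>) - p z))\<^sup>2
          = 4 * (Re (p (M \<zeta>)) * Re (p z))"
        unfolding cmod_power2 by (simp add: power2_eq_square algebra_simps)
      moreover have "\<dots> > 0" using pos[OF M_lt[OF that]] pos[OF z] by simp
      ultimately have "(norm (p (M \<zeta>) - p z))\<^sup>2 < (norm (p (M \<zeta>) + cnj (p z)))\<^sup>2"
        by linarith
      then have "norm (p (M \<zeta>) - p z) < norm (p (M \<zeta>) + cnj (p z))"
        by (rule power_less_imp_less_base) simp
      then show ?thesis
        using denom[OF that] by (simp add: H_def norm_divide)
    qed
  qed simp
  moreover have "deriv H 0 = deriv p z * of_real (1 - (norm z)\<^sup>2) / of_real (2 * Re (p z))"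
  proof (rule DERIV_imp_deriv)
    have "(p has_field_derivative deriv p z) (at (M 0))"
      using holomorphic_derivI[OF p] z by (simp add: M0)
    then have d: "((\<lambda>\<zeta>. p (M \<zeta>)) has_field_derivative deriv p z * of_real (1 - (norm z)\<^sup>2)) (at 0)"
      using dM by (rule DERIV_chain2)
    have s: "p z + cnj (p z) = of_real (2 * Re (p z))" by (simp add: complex_eq_iff)
    show "(H has_field_derivative deriv p z * of_real (1 - (norm z)\<^sup>2) / of_real (2 * Re (p z))) (at 0)"
      unfolding H_def
      by (rule derivative_eq_intros d refl)+
         (use denom[of 0] s in \<open>auto simp: M0 divide_simps algebra_simps\<close>)
  qed
  ultimately have "norm (deriv p z) * (1 - (norm z)\<^sup>2) / (2 * Re (p z)) \<le> 1"
    using pos[OF z] z by (simp add: norm_mult norm_divide abs_square_le_1 del: of_real_diff)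
  moreover have "1 - (norm z)\<^sup>2 > 0" using z by (simp add: abs_square_less_1)
  ultimately show ?thesis using pos[OF z] by (simp add: field_simps)
qed

text \<open>The map \<open>\<omega> \<mapsto> exp (\<i> \<omega>)\<close> sends the strip to the right half-plane. Both the derivative and the
  real part of the image carry the factor \<open>exp (- Im \<omega>)\<close>, so the half-plane bound becomes one
  that does not involve \<open>Im \<omega>\<close>.\<close>

lemma norm_deriv_le_cos_of_Re_strip:
  assumes w: "w holomorphic_on ball 0 1"
    and strip: "\<And>z. norm z < 1 \<Longrightarrow> \<bar>Re (w z)\<bar> < pi / 2"
    and z: "norm z < 1"
  shows "norm (deriv w z) \<le> 2 * cos (Re (w z)) / (1 - (norm z)\<^sup>2)"
proof -
  define p where "p z = exp (\<i> * w z)" for z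
  have Re_p: "Re (p z) = exp (- Im (w z)) * cos (Re (w z))" for z
    by (simp add: p_def Re_exp)
  have "p holomorphic_on ball 0 1"
    unfolding p_def by (intro holomorphic_intros w)
  moreover have "Re (p z) > 0" if "norm z < 1" for z
    using strip[OF that] by (simp add: Re_p abs_less_iff cos_gt_zero_pi del: less_divide_eq_numeral1)
  ultimately have "norm (deriv p z) \<le> 2 * Re (p z) / (1 - (norm z)\<^sup>2)"
    using z by (rule norm_deriv_le_of_Re_pos)
  moreover have "deriv p z = exp (\<i> * w z) * (\<i> * deriv w z)"
    unfolding p_def
    by (rule DERIV_imp_deriv)
      (auto intro!: derivative_eq_intros holomorphic_derivI[OF w] simp: z)
  ultimately have "exp (- Im (w z)) * norm (deriv w z)
      \<le> exp (- Im (w z)) * (2 * cos (Re (w z)) / (1 - (norm z)\<^sup>2))"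
    by (simp add: norm_mult Re_p mult_ac)
  then show ?thesis
    by (simp only: mult_le_cancel_left_pos[OF exp_gt_zero])
qed

section \<open>The gradient estimate\<close>

lemma norm_gradient_le_cos:
  fixes \<alpha> \<beta> :: real and u :: "complex \<Rightarrow> real"
  assumes "\<alpha> < \<beta>" and u: "harmonic_on (ball 0 1) u" and range: "u ` ball 0 1 \<subseteq> {\<alpha><..<\<beta>}"
    and z: "z \<in> ball 0 1"
  shows "norm (gradient u z) \<le> 2 * (\<beta> - \<alpha>) / pi *
    (cos (pi / (\<beta> - \<alpha>) * (u z - (\<alpha> + \<beta>) / 2)) / (1 - (norm z)\<^sup>2))"
proof -
  obtain f where f: "f holomorphic_on ball 0 1" and uf: "\<And>z. z \<in> ball 0 1 \<Longrightarrow> u z = Re (f z)"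
    using harmonic_on_convex_imp_Re_holomorphic[OF u convex_ball] by blast
  define c where "c = pi / (\<beta> - \<alpha>)"
  have c: "c > 0" using \<open>\<alpha> < \<beta>\<close> by (simp add: c_def)
  define w where "w z = of_real c * (f z - of_real ((\<alpha> + \<beta>) / 2))" for z
  have Re_w: "Re (w z) = c * (u z - (\<alpha> + \<beta>) / 2)" if "z \<in> ball 0 1" for z
    by (simp add: w_def uf[OF that])
  have "norm (deriv w z) \<le> 2 * cos (Re (w z)) / (1 - (norm z)\<^sup>2)"
  proof (rule norm_deriv_le_cos_of_Re_strip)
    show "w holomorphic_on ball 0 1"
      unfolding w_def by (intro holomorphic_intros f)
    show "\<bar>Re (w \<zeta>)\<bar> < pi / 2" if "norm \<zeta> < 1" for \<zeta>
    proof -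
      have \<zeta>: "\<zeta> \<in> ball 0 1" using that by simp
      then have "\<alpha> < u \<zeta>" "u \<zeta> < \<beta>" using range by (auto simp only: image_subset_iff greaterThanLessThan_iff)
      then have "\<bar>u \<zeta> - (\<alpha> + \<beta>) / 2\<bar> < (\<beta> - \<alpha>) / 2"
        by (simp add: abs_less_iff field_simps)
      then have "c * \<bar>u \<zeta> - (\<alpha> + \<beta>) / 2\<bar> < c * ((\<beta> - \<alpha>) / 2)" using c by simp
      also have "c * ((\<beta> - \<alpha>) / 2) = pi / 2" using \<open>\<alpha> < \<beta>\<close> by (simp add: c_def)
      finally show ?thesis using c by (simp add: Re_w[OF \<zeta>] abs_mult)
    qed
  qed (use z in simp)
  moreover have "deriv w z = of_real c * deriv f z"
    unfolding w_def
    by (rule DERIV_imp_deriv) (auto intro!: derivative_eq_intros holomorphic_derivI[OF f _ z])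
  moreover have "norm (gradient u z) = norm (deriv f z)"
    using f open_ball uf z by (rule norm_gradient_Re_holomorphic)
  ultimately have "c * norm (gradient u z) \<le> 2 * cos (Re (w z)) / (1 - (norm z)\<^sup>2)"
    using c by (simp add: norm_mult)
  then have "norm (gradient u z) \<le> 2 * cos (Re (w z)) / (1 - (norm z)\<^sup>2) / c"
    using c by (simp only: pos_le_divide_eq mult.commute)
  also have "\<dots> = 2 * (\<beta> - \<alpha>) / pi * (cos (Re (w z)) / (1 - (norm z)\<^sup>2))"
    by (simp add: c_def algebra_simps)
  finally show ?thesis by (simp only: Re_w[OF z] c_def)
qed

text \<open>The conformal map of the disk onto the strip that sends \<open>0\<close> to the midpoint: \<open>(1 + z) / (1 - z)\<close>
  maps the disk onto the right half-plane, and \<open>- \<i> Ln\<close> maps the half-plane onto the strip of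
  width \<open>\<pi>\<close> around the imaginary axis. Where \<open>u\<close> has the midpoint value the cosine equals \<open>1\<close>,
  so the values at \<open>0\<close> are those of equality.\<close>

lemma norm_gradient_le_cos_sharp:
  fixes \<alpha> \<beta> :: real
  assumes "\<alpha> < \<beta>"
  obtains u :: "complex \<Rightarrow> real" where "harmonic_on (ball 0 1) u" "u ` ball 0 1 \<subseteq> {\<alpha><..<\<beta>}"
    "u 0 = (\<alpha> + \<beta>) / 2" "norm (gradient u 0) = 2 * (\<beta> - \<alpha>) / pi"
proof -
  define c where "c = pi / (\<beta> - \<alpha>)"
  have c: "c > 0" using \<open>\<alpha> < \<beta>\<close> by (simp add: c_def)
  define f where "f z = of_real ((\<alpha> + \<beta>) / 2) - \<i> / of_real c * Ln ((1 + z) / (1 - z))" for z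
  define u where "u z = Re (f z)" for z
  have Re_pos: "0 < Re ((1 + z) / (1 - z))" if "norm z < 1" for z :: complex
  proof -
    have "Re ((1 + z) / (1 - z)) = (1 - (norm z)\<^sup>2) / (norm (1 - z))\<^sup>2"
      unfolding cmod_power2 Re_divide by (simp add: power2_eq_square algebra_simps)
    moreover have "1 - (norm z)\<^sup>2 > 0" "1 - z \<noteq> 0"
      using that by (auto simp: abs_square_less_1)
    ultimately show ?thesis by simp
  qed
  have f: "f holomorphic_on ball 0 1"
    unfolding f_def
  proof (intro holomorphic_intros)
    fix z :: complex assume "z \<in> ball 0 1"
    then show "(1 + z) / (1 - z) \<notin> \<real>\<^sub>\<le>\<^sub>0"
      using Re_pos[of z] by (auto simp: complex_nonpos_Reals_iff)
  qed (use c in auto)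
  have df: "(f has_field_derivative - \<i> / of_real c * 2) (at 0)"
    unfolding f_def by (rule derivative_eq_intros refl | use c in simp)+
  show ?thesis
  proof
    show "harmonic_on (ball 0 1) u"
      by (rule harmonic_on_Re_holomorphic[OF f]) (auto simp: u_def)
    show "u ` ball 0 1 \<subseteq> {\<alpha><..<\<beta>}"
    proof clarify
      fix z :: complex assume z: "z \<in> ball 0 1"
      have "(1 + z) / (1 - z) \<noteq> 0" using Re_pos[of z] z by force
      then have "\<bar>Im (Ln ((1 + z) / (1 - z)))\<bar> < pi / 2"
        using Re_pos[of z] z by (subst Re_Ln_pos_lt) (simp_all del: Re_divide)
      then have "\<bar>Im (Ln ((1 + z) / (1 - z))) / c\<bar> < (pi / 2) / c"
        using c by (simp only: abs_divide abs_of_pos divide_strict_right_mono)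
      also have "(pi / 2) / c = (\<beta> - \<alpha>) / 2" by (simp add: c_def)
      finally have "\<bar>Im (Ln ((1 + z) / (1 - z))) / c\<bar> < (\<beta> - \<alpha>) / 2" .
      moreover have "u z = (\<alpha> + \<beta>) / 2 + Im (Ln ((1 + z) / (1 - z))) / c"
        by (simp add: u_def f_def)
      ultimately show "u z \<in> {\<alpha><..<\<beta>}"
        by (auto simp only: abs_less_iff greaterThanLessThan_iff) (simp_all add: field_simps)
    qed
    show "u 0 = (\<alpha> + \<beta>) / 2" by (simp add: u_def f_def)
    have "norm (gradient u 0) = norm (deriv f 0)"
      by (rule norm_gradient_Re_holomorphic[OF f]) (auto simp: u_def)
    also have "\<dots> = 2 / c"
      unfolding DERIV_imp_deriv[OF df] using c by (simp add: norm_mult norm_divide)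
    finally show "norm (gradient u 0) = 2 * (\<beta> - \<alpha>) / pi" by (simp add: c_def)
  qed
qed

theorem theorem4p6:
  fixes \<alpha> \<beta> :: real
  assumes "\<alpha> < \<beta>"
  shows "(\<forall>u :: complex \<Rightarrow> real.
            harmonic_on (ball 0 1) u \<and> u ` ball 0 1 \<subseteq> {\<alpha><..<\<beta>} \<longrightarrow>
            (\<forall>z\<in>ball 0 1.
               norm (gradient u z) \<le> 2 * (\<beta> - \<alpha>) / pi *
                 (cos (pi / (\<beta> - \<alpha>) * (u z - (\<alpha> + \<beta>) / 2)) / (1 - (norm z)\<^sup>2)))) \<and>
         (\<exists>u :: complex \<Rightarrow> real.
            harmonic_on (ball 0 1) u \<and> u ` ball 0 1 \<subseteq> {\<alpha><..<\<beta>} \<and>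
            (\<exists>z\<in>ball 0 1.
               norm (gradient u z) = 2 * (\<beta> - \<alpha>) / pi *
                 (cos (pi / (\<beta> - \<alpha>) * (u z - (\<alpha> + \<beta>) / 2)) / (1 - (norm z)\<^sup>2))))"
proof (intro conjI allI impI ballI)
  fix u :: "complex \<Rightarrow> real" and z :: complex
  assume "harmonic_on (ball 0 1) u \<and> u ` ball 0 1 \<subseteq> {\<alpha><..<\<beta>}" "z \<in> ball 0 1"
  then show "norm (gradient u z) \<le> 2 * (\<beta> - \<alpha>) / pi *
      (cos (pi / (\<beta> - \<alpha>) * (u z - (\<alpha> + \<beta>) / 2)) / (1 - (norm z)\<^sup>2))"
    using norm_gradient_le_cos[OF assms] by blast
next
  obtain u :: "complex \<Rightarrow> real"
    where u: "harmonic_on (ball 0 1) u" "u ` ball 0 1 \<subseteq> {\<alpha><..<\<beta>}"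
    and u0: "u 0 = (\<alpha> + \<beta>) / 2" "norm (gradient u 0) = 2 * (\<beta> - \<alpha>) / pi"
    using norm_gradient_le_cos_sharp[OF assms] by blast
  have "norm (gradient u 0) = 2 * (\<beta> - \<alpha>) / pi *
      (cos (pi / (\<beta> - \<alpha>) * (u 0 - (\<alpha> + \<beta>) / 2)) / (1 - (norm (0::complex))\<^sup>2))"
    by (simp add: u0)
  then show "\<exists>u :: complex \<Rightarrow> real.
            harmonic_on (ball 0 1) u \<and> u ` ball 0 1 \<subseteq> {\<alpha><..<\<beta>} \<and>
            (\<exists>z\<in>ball 0 1.
               norm (gradient u z) = 2 * (\<beta> - \<alpha>) / pi *
                 (cos (pi / (\<beta> - \<alpha>) * (u z - (\<alpha> + \<beta>) / 2)) / (1 - (norm z)\<^sup>2)))"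
    using u by (intro exI[of _ u] conjI bexI[of _ 0]) auto
qed

end
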